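(* Let $k$ be a field, $\Gamma$ an abelian group, and $R$ a PDCF $\Gamma$-graded $k$-algebra which is an integral domain. If $P$ is a BDF $\Gamma$-graded $R$-module which is projective as an $R$-module, then $P$ is free, and in fact $P$ is isomorphic (as a $\Gamma$-graded $R$-module) to $\bigoplus_{i \in I} R(-g_i)$ for some BDF family $(g_i \mid i \in I)$ of elements of $\Gamma$.
   Context: Abelian groups and monoids are written additively. A $\Gamma$-graded $k$-algebra is a commutative $k$-algebra $R$ with $k$-subspaces $R_g$ ($g\in\Gamma$) such that $R=\bigoplus_{g\in\Gamma}R_g$ and $R_gR_h\subseteq R_{g+h}$. A $\Gamma$-graded $R$-module is an $R$-module $M$ with $k$-subspaces $M_g$ such that $M=\bigoplus_{g\in\Gamma}M_g$ and $R_gM_h\subseteq M_{g+h}$. An $R$-linear map $\varphi:M\to N$ is graded if $\varphi(M_g)\subseteq N_g$ for all $g$. The shift $M(g)$ is $M$ with grading $M(g)_h=M_{g+h}$. Write $\mathrm{Supp}_\Gamma(M)=\{g\in\Gamma\mid M_g\neq 0\}$. Since $R$ is a domain, $Q:=\mathrm{Supp}_\Gamma(R)$ is a submonoid of $\Gamma$ (the image monoid). $Q$ is pointed if $p+q=0$ with $p,q\in Q$ implies $p=q=0$; then $g\le_Q h :\iff h-g\in Q$ is a partial order on $\Gamma$. A subset $U\subseteq\Gamma$ is downward finite if for every $g\in\Gamma$ the set $\{u\in U\mid u\le_Q g\}$ is finite; it is finitely bounded below if there are finitely many $p_1,\dots,p_n\in\Gamma$ such that every $u\in U$ satisfies $p_i\le_Q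 u$ for some $i$. $R$ is PDCF if $Q$ is pointed and downward finite, $R$ is connected ($R_0=k$), and $\dim_k R_g<\infty$ for all $g\in\Gamma$. A $\Gamma$-graded $R$-module $M$ is BDF if $\mathrm{Supp}_\Gamma(M)$ is finitely bounded below and downward finite and $\dim_k M_g<\infty$ for all $g\in\Gamma$. A family $(g_i\mid i\in I)$ of elements of $\Gamma$ is a BDF family if the set $\{g_i\mid i\in I\}$ is downward finite and finitely bounded below and for each $g\in\Gamma$ the set $\{i\in I\mid g_i=g\}$ is finite. *)

theory Defs
  imports Complex_Main "HOL-Library.Poly_Mapping"
begin

definition monoid_le :: "'g::ab_group_add set \<Rightarrow> 'g \<Rightarrow> 'g \<Rightarrow> bool" where
  "monoid_le Q g h \<longleftrightarrow> h - g \<in> Q"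

definition pointed :: "'g::ab_group_add set \<Rightarrow> bool" where
  "pointed Q \<longleftrightarrow> (\<forall>p\<in>Q. \<forall>q\<in>Q. p + q = 0 \<longrightarrow> p = 0 \<and> q = 0)"

definition downward_finite :: "'g::ab_group_add set \<Rightarrow> 'g set \<Rightarrow> bool" where
  "downward_finite Q U \<longleftrightarrow> (\<forall>g. finite {u \<in> U. monoid_le Q u g})"

definition finitely_bounded_below :: "'g::ab_group_add set \<Rightarrow> 'g set \<Rightarrow> bool" where
  "finitely_bounded_below Q U \<longleftrightarrow>
     (\<exists>B. finite B \<and> (\<forall>u\<in>U. \<exists>p\<in>B. monoid_le Q p u))"

text \<open>Internal direct sum decomposition of a vector space, with scalar multiplication \<open>s\<close>,
  into a family of subspaces.\<close>

definition is_grading :: "('k::field \<Rightarrow> 'v::ab_group_add \<Rightarrow> 'v) \<Rightarrow> ('g \<Rightarrow> 'v set) \<Rightarrow> bool" where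
  "is_grading s V \<longleftrightarrow>
     (\<forall>g. module.subspace s (V g)) \<and>
     (\<forall>x. \<exists>!f :: 'g \<Rightarrow>\<^sub>0 'v.
        (\<forall>g. Poly_Mapping.lookup f g \<in> V g) \<and>
        x = (\<Sum>g\<in>Poly_Mapping.keys f. Poly_Mapping.lookup f g))"

definition Supp :: "('g \<Rightarrow> 'v::zero set) \<Rightarrow> 'g set" where
  "Supp V = {g. V g \<noteq> {0}}"

definition fin_dim :: "('k::field \<Rightarrow> 'v::ab_group_add \<Rightarrow> 'v) \<Rightarrow> 'v set \<Rightarrow> bool" where
  "fin_dim s V \<longleftrightarrow> (\<exists>B. finite B \<and> module.span s B = V)"

locale k_algebra = vector_space scaleK
  for scaleK :: "'k::field \<Rightarrow> 'r::comm_ring_1 \<Rightarrow> 'r" +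
  assumes scaleK_mult_left: "scaleK c (x * y) = scaleK c x * y"

locale graded_algebra = k_algebra scaleK
  for scaleK :: "'k::field \<Rightarrow> 'r::comm_ring_1 \<Rightarrow> 'r" +
  fixes R :: "'g::ab_group_add \<Rightarrow> 'r set"
  assumes grading: "is_grading scaleK R"
    and mult_closed: "x \<in> R g \<Longrightarrow> y \<in> R h \<Longrightarrow> x * y \<in> R (g + h)"

text \<open>The \<open>k\<close>-structure of an \<open>R\<close>-module, by restriction of scalars along
  \<open>c \<mapsto> c \<cdot> 1\<close>.\<close>

definition restrict_scalars ::
  "('k \<Rightarrow> 'r \<Rightarrow> 'r::one) \<Rightarrow> ('r \<Rightarrow> 'm \<Rightarrow> 'm) \<Rightarrow> 'k \<Rightarrow> 'm \<Rightarrow> 'm" where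
  "restrict_scalars scaleK scaleM = (\<lambda>c. scaleM (scaleK c 1))"

locale graded_module = graded_algebra scaleK R + mod: module scaleM
  for scaleK :: "'k::field \<Rightarrow> 'r::comm_ring_1 \<Rightarrow> 'r"
    and R :: "'g::ab_group_add \<Rightarrow> 'r set"
    and scaleM :: "'r \<Rightarrow> 'm::ab_group_add \<Rightarrow> 'm" +
  fixes M :: "'g \<Rightarrow> 'm set"
  assumes module_grading: "is_grading (restrict_scalars scaleK scaleM) M"
    and scale_closed: "a \<in> R g \<Longrightarrow> x \<in> M h \<Longrightarrow> scaleM a x \<in> M (g + h)"

definition PDCF ::
  "('k::field \<Rightarrow> 'r::comm_ring_1 \<Rightarrow> 'r) \<Rightarrow> ('g::ab_group_add \<Rightarrow> 'r set) \<Rightarrow> bool" where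
  "PDCF scaleK R \<longleftrightarrow>
     graded_algebra scaleK R \<and>
     pointed (Supp R) \<and>
     downward_finite (Supp R) (Supp R) \<and>
     R 0 = range (\<lambda>c. scaleK c 1) \<and>
     (\<forall>g. fin_dim scaleK (R g))"

definition BDF_module ::
  "('k::field \<Rightarrow> 'r::comm_ring_1 \<Rightarrow> 'r) \<Rightarrow> ('g::ab_group_add \<Rightarrow> 'r set) \<Rightarrow>
   ('r \<Rightarrow> 'm::ab_group_add \<Rightarrow> 'm) \<Rightarrow> ('g \<Rightarrow> 'm set) \<Rightarrow> bool" where
  "BDF_module scaleK R scaleM M \<longleftrightarrow>
     graded_module scaleK R scaleM M \<and>
     finitely_bounded_below (Supp R) (Supp M) \<and>
     downward_finite (Supp R) (Supp M) \<and>
     (\<forall>g. fin_dim (restrict_scalars scaleK scaleM) (M g))"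

definition BDF_family :: "'g::ab_group_add set \<Rightarrow> 'i set \<Rightarrow> ('i \<Rightarrow> 'g) \<Rightarrow> bool" where
  "BDF_family Q I g \<longleftrightarrow>
     downward_finite Q (g ` I) \<and> finitely_bounded_below Q (g ` I) \<and>
     (\<forall>h. finite {i \<in> I. g i = h})"

text \<open>The lifting property against all surjective linear maps \<open>N \<rightarrow> L\<close> between modules whose
  underlying abelian groups are the types \<open>'n\<close> and \<open>'l\<close>. A formula cannot quantify over all
  types; for a module on \<open>'m\<close> over a ring \<open>'r\<close>, the choice \<open>'n = 'm \<Rightarrow>\<^sub>0 'r\<close> and
  \<open>'l = 'm\<close> already implies the property at all other types, since it splits the canonical
  surjection from the free module on the set of all elements of the module.\<close>

definition projective_wrt ::
  "'n::ab_group_add itself \<Rightarrow> 'l::ab_group_add itself \<Rightarrow>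
   ('r::comm_ring_1 \<Rightarrow> 'm::ab_group_add \<Rightarrow> 'm) \<Rightarrow> bool" where
  "projective_wrt _ _ scaleP \<longleftrightarrow>
     (\<forall>(scaleN :: 'r \<Rightarrow> 'n \<Rightarrow> 'n) (scaleL :: 'r \<Rightarrow> 'l \<Rightarrow> 'l) p f.
        module_hom scaleN scaleL p \<and> surj p \<and> module_hom scaleP scaleL f \<longrightarrow>
        (\<exists>l. module_hom scaleP scaleN l \<and> p \<circ> l = f))"

definition projective :: "('r::comm_ring_1 \<Rightarrow> 'm::ab_group_add \<Rightarrow> 'm) \<Rightarrow> bool" where
  "projective scaleP \<longleftrightarrow>
     module scaleP \<and> projective_wrt TYPE('m \<Rightarrow>\<^sub>0 'r) TYPE('m) scaleP"

definition free :: "('r::comm_ring_1 \<Rightarrow> 'm::ab_group_add \<Rightarrow> 'm) \<Rightarrow> bool" where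
  "free scaleM \<longleftrightarrow>
     (\<exists>B. \<not> module.dependent scaleM B \<and> module.span scaleM B = UNIV)"

definition shift :: "('g::ab_group_add \<Rightarrow> 'v set) \<Rightarrow> 'g \<Rightarrow> 'g \<Rightarrow> 'v set" where
  "shift V g h = V (g + h)"

text \<open>The direct sum of copies of \<open>R\<close> indexed by a set \<open>I\<close> is the submodule of the finitely
  supported functions vanishing outside \<open>I\<close>.\<close>

definition sum_scale :: "'r::comm_ring_1 \<Rightarrow> ('i \<Rightarrow>\<^sub>0 'r) \<Rightarrow> ('i \<Rightarrow>\<^sub>0 'r)" where
  "sum_scale a = Poly_Mapping.map ((*) a)"

definition sum_carrier :: "'i set \<Rightarrow> ('i \<Rightarrow>\<^sub>0 'r::comm_ring_1) set" where
  "sum_carrier I = {f. Poly_Mapping.keys f \<subseteq> I}"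

definition sum_grading ::
  "'i set \<Rightarrow> ('i \<Rightarrow> 'g \<Rightarrow> 'r::comm_ring_1 set) \<Rightarrow> 'g \<Rightarrow> ('i \<Rightarrow>\<^sub>0 'r) set" where
  "sum_grading I N h = {f \<in> sum_carrier I. \<forall>i\<in>I. Poly_Mapping.lookup f i \<in> N i h}"

lemma lookup_sum_scale [simp]:
  "Poly_Mapping.lookup (sum_scale a f) i = a * Poly_Mapping.lookup f i"
  by (simp add: sum_scale_def Poly_Mapping.map.rep_eq when_def)

lemma module_sum_scale: "module (sum_scale :: 'r::comm_ring_1 \<Rightarrow> ('i \<Rightarrow>\<^sub>0 'r) \<Rightarrow> _)"
  by unfold_locales (auto intro!: poly_mapping_eqI simp: lookup_add algebra_simps)

lemma subspace_sum_carrier: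
  "module.subspace sum_scale (sum_carrier I :: ('i \<Rightarrow>\<^sub>0 'r::comm_ring_1) set)"
proof -
  have "sum_carrier I = {f :: 'i \<Rightarrow>\<^sub>0 'r. \<forall>i. i \<notin> I \<longrightarrow> Poly_Mapping.lookup f i = 0}"
    by (auto simp: sum_carrier_def in_keys_iff subset_iff)
  then show ?thesis
    by (simp add: module.subspace_def[OF module_sum_scale] lookup_add)
qed

text \<open>Isomorphism of graded modules from a module onto the submodule \<open>C\<close> of another module.
  The equality of graded pieces says that both the map and its inverse are graded.\<close>

definition graded_iso_onto ::
  "('r::comm_ring_1 \<Rightarrow> 'm::ab_group_add \<Rightarrow> 'm) \<Rightarrow> ('g \<Rightarrow> 'm set) \<Rightarrow>
   ('r \<Rightarrow> 'n::ab_group_add \<Rightarrow> 'n) \<Rightarrow> 'n set \<Rightarrow> ('g \<Rightarrow> 'n set) \<Rightarrow> ('m \<Rightarrow> 'n) \<Rightarrow> bool" where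
  "graded_iso_onto scaleM M scaleN C N \<phi> \<longleftrightarrow>
     module_hom scaleM scaleN \<phi> \<and> bij_betw \<phi> UNIV C \<and> (\<forall>g. \<phi> ` M g = N g)"

end

theory Submission
  imports Defs
begin

text \<open>Let \<open>\<mm>\<close> be the ideal of \<open>R\<close> spanned by the pieces of nonzero degree, and lift bases of the
  pieces of \<open>P / \<mm>P\<close> to a set \<open>G\<close> of homogeneous elements of \<open>P\<close>. As the support is downward
  finite, \<open>G\<close> generates \<open>P\<close> (Nakayama). Projectivity expresses every \<open>b \<in> G\<close> as
  \<open>\<Sum>c. l\<^sub>c(b) c\<close> with \<open>R\<close>-linear maps \<open>l\<^sub>c\<close>, and minimality of \<open>G\<close> forces the matrix of the
  components of \<open>l\<^sub>c(b)\<close> in degree \<open>deg b - deg c\<close> to be unitriangular for the order \<open>\<le>\<^sub>Q\<close> on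
  degrees. So applying \<open>l\<^sub>c\<close> to a homogeneous relation \<open>\<Sum>b. r\<^sub>b b = 0\<close>, with \<open>c\<close> of maximal
  degree such that \<open>r\<^sub>c \<noteq> 0\<close>, yields \<open>r\<^sub>c = 0\<close>; hence \<open>G\<close> is a basis.\<close>

section \<open>Homogeneous components in a graded vector space\<close>

text \<open>No scalar multiplication occurs, so one constant serves both \<open>R\<close> and
  \<open>M\<close>.\<close>

definition component :: "('g \<Rightarrow> 'v::ab_group_add set) \<Rightarrow> 'v \<Rightarrow> 'g \<Rightarrow> 'v" where
  "component V x = Poly_Mapping.lookup
     (THE f. (\<forall>g. Poly_Mapping.lookup f g \<in> V g) \<and>
        x = (\<Sum>g\<in>Poly_Mapping.keys f. Poly_Mapping.lookup f g))"

locale graded_vector_space = vector_space scale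
  for scale :: "'k::field \<Rightarrow> 'v::ab_group_add \<Rightarrow> 'v" +
  fixes V :: "'g \<Rightarrow> 'v set"
  assumes is_grading: "is_grading scale V"
begin

lemma subspace_piece: "subspace (V g)"
  using is_grading by (simp add: is_grading_def)

lemma zero_mem: "0 \<in> V g"
  by (rule subspace_0[OF subspace_piece])

lemma ex1_decomposition:
  "\<exists>!f :: 'g \<Rightarrow>\<^sub>0 'v. (\<forall>g. Poly_Mapping.lookup f g \<in> V g) \<and>
     x = (\<Sum>g\<in>Poly_Mapping.keys f. Poly_Mapping.lookup f g)"
  using is_grading by (simp add: is_grading_def)

lemma component_mem: "component V x g \<in> V g"
  unfolding component_def using theI'[OF ex1_decomposition[of x]] by blast

lemma finite_component: "finite {g. component V x g \<noteq> 0}"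
  unfolding component_def by simp

lemma sum_component: "(\<Sum>g | component V x g \<noteq> 0. component V x g) = x"
  unfolding component_def using theI'[OF ex1_decomposition[of x]]
  by (simp add: keys.rep_eq)

text \<open>Padded by zero outside \<open>S\<close>, \<open>f\<close> is a decomposition of the sum,
  hence by uniqueness the one that \<open>component\<close> selects.\<close>

lemma component_sum_pieces:
  assumes "finite S" and "\<And>g. g \<in> S \<Longrightarrow> f g \<in> V g"
  shows "component V (\<Sum>g\<in>S. f g) h = (if h \<in> S then f h else 0)"
proof -
  let ?f = "\<lambda>g. if g \<in> S then f g else 0"
  let ?F = "Abs_poly_mapping ?f"
  have "finite {g. ?f g \<noteq> 0}"
    by (rule finite_subset[OF _ \<open>finite S\<close>]) auto
  then have F: "Poly_Mapping.lookup ?F = ?f"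
    by (rule lookup_Abs_poly_mapping)
  have "(\<forall>g. Poly_Mapping.lookup ?F g \<in> V g) \<and>
      (\<Sum>g\<in>S. f g) = (\<Sum>g\<in>Poly_Mapping.keys ?F. Poly_Mapping.lookup ?F g)"
    unfolding keys.rep_eq F
    using assms zero_mem
    by (auto intro!: sum.mono_neutral_cong_right)
  then have "(THE f'. (\<forall>g. Poly_Mapping.lookup f' g \<in> V g) \<and>
      (\<Sum>g\<in>S. f g) = (\<Sum>g\<in>Poly_Mapping.keys f'. Poly_Mapping.lookup f' g)) = ?F"
    by (rule the1_equality[OF ex1_decomposition])
  then show ?thesis
    unfolding component_def by (simp add: F)
qed

lemma component_homogeneous:
  assumes "x \<in> V g"
  shows "component V x h = (if h = g then x else 0)"
  using component_sum_pieces[of "{g}" "\<lambda>_. x"] assms by simp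

lemma component_zero [simp]: "component V 0 h = 0"
  using component_homogeneous[OF zero_mem] by simp

lemma component_add: "component V (x + y) h = component V x h + component V y h"
proof -
  \<comment> \<open>The decompositions of \<open>x\<close> and \<open>y\<close> may have different
    supports; over the union they add termwise.\<close>
  let ?S = "{g. component V x g \<noteq> 0} \<union> {g. component V y g \<noteq> 0}"
  have fin: "finite ?S"
    by (simp add: finite_component)
  have "(\<Sum>g | component V z g \<noteq> 0. component V z g) = (\<Sum>g\<in>?S. component V z g)"
    if "z \<in> {x, y}" for z
    using that fin by (intro sum.mono_neutral_left) auto
  then have "x + y = (\<Sum>g\<in>?S. component V x g) + (\<Sum>g\<in>?S. component V y g)"
    by (simp add: sum_component)
  also have "\<dots> = (\<Sum>g\<in>?S. component V x g + component V y g)"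
    by (rule sum.distrib[symmetric])
  finally have "component V (x + y) h =
      component V (\<Sum>g\<in>?S. component V x g + component V y g) h"
    by (rule arg_cong)
  also have "\<dots> = component V x h + component V y h"
    by (subst component_sum_pieces[OF fin])
      (auto intro: subspace_add[OF subspace_piece] component_mem)
  finally show ?thesis .
qed

lemma component_sum: "component V (\<Sum>i\<in>S. f i) h = (\<Sum>i\<in>S. component V (f i) h)"
  by (induction S rule: infinite_finite_induct) (simp_all add: component_add)

lemma homogeneous_unique: "x \<in> V g \<Longrightarrow> x \<in> V h \<Longrightarrow> x \<noteq> 0 \<Longrightarrow> g = h"
  using component_homogeneous[of x g g] component_homogeneous[of x h g]
  by (auto split: if_splits)

end

section \<open>Graded algebras and modules as graded vector spaces\<close>

sublocale graded_algebra \<subseteq> ring: graded_vector_space scaleK R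
  by unfold_locales (rule grading)

lemma (in k_algebra) scaleK_conv_mult: "scaleK c x = scaleK c 1 * x"
  using scaleK_mult_left[of c 1 x] by simp

lemma (in k_algebra) vector_space_restrict_scalars:
  assumes "module scaleM"
  shows "vector_space (restrict_scalars scaleK scaleM)"
proof -
  interpret m: module scaleM by fact
  show ?thesis
    by unfold_locales
      (simp_all add: restrict_scalars_def m.scale_right_distrib scale_left_distrib
        m.scale_left_distrib flip: scaleK_conv_mult)
qed

sublocale graded_module \<subseteq> vs: graded_vector_space "restrict_scalars scaleK scaleM" M
proof -
  interpret v: vector_space "restrict_scalars scaleK scaleM"
    by (rule vector_space_restrict_scalars[OF mod.module_axioms])
  show "graded_vector_space (restrict_scalars scaleK scaleM) M"
    by unfold_locales (rule module_grading)
qed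

text \<open>Makes \<open>component_scale\<close> applicable to products in \<open>R\<close>.\<close>

lemma (in graded_algebra) graded_module_self: "graded_module scaleK R (*) R"
proof -
  have "restrict_scalars scaleK (*) = scaleK"
    by (simp add: restrict_scalars_def fun_eq_iff flip: scaleK_conv_mult)
  then show ?thesis
    by unfold_locales (auto simp: algebra_simps grading mult_closed)
qed

context graded_module
begin

text \<open>The part of \<open>r\<close> of degree \<open>d\<close> sends \<open>x\<close> to degree
  \<open>d + g\<close>, so only \<open>d = h - g\<close> contributes.\<close>

lemma component_scale:
  assumes "x \<in> M g"
  shows "component M (scaleM r x) h = scaleM (component R r (h - g)) x"
proof -
  let ?D = "{d. component R r d \<noteq> 0}"
  have "scaleM r x = scaleM (\<Sum>d\<in>?D. component R r d) x"
    by (simp add: ring.sum_component)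
  also have "\<dots> = (\<Sum>d\<in>?D. scaleM (component R r d) x)"
    by (rule mod.scale_sum_left)
  finally have "component M (scaleM r x) h =
      (\<Sum>d\<in>?D. component M (scaleM (component R r d) x) h)"
    by (simp add: vs.component_sum)
  also have "\<dots> = (\<Sum>d\<in>?D. if d = h - g then scaleM (component R r d) x else 0)"
    by (rule sum.cong[OF refl])
      (auto simp: vs.component_homogeneous[OF scale_closed[OF ring.component_mem assms]])
  also have "\<dots> = scaleM (component R r (h - g)) x"
    by (simp add: sum.delta'[OF ring.finite_component] sum.delta[OF ring.finite_component])
  finally show ?thesis .
qed

section \<open>Decomposable elements and their complements\<close>

text \<open>The piece of degree \<open>g\<close> of \<mm>M, written as a span over k so that the
  choice of generators is linear algebra in each degree.\<close>

definition decomposable_part :: "'g \<Rightarrow> 'm set" where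
  "decomposable_part g = vs.span {scaleM a x |a x q. q \<noteq> 0 \<and> a \<in> R q \<and> x \<in> M (g - q)}"

lemma decomposable_part_subset: "decomposable_part g \<subseteq> M g"
  unfolding decomposable_part_def
proof (rule vs.span_minimal[OF _ vs.subspace_piece])
  show "{scaleM a x |a x q. q \<noteq> 0 \<and> a \<in> R q \<and> x \<in> M (g - q)} \<subseteq> M g"
    using scale_closed[of _ _ _ "g - _"] by force
qed

lemma scale_mem_decomposable_part:
  assumes "a \<in> R q" "x \<in> M h" "q \<noteq> 0" "q + h = g"
  shows "scaleM a x \<in> decomposable_part g"
  unfolding decomposable_part_def using assms
  by (intro vs.span_base) (force simp: algebra_simps)

text \<open>\<open>B\<close> lifts a basis of \<open>M g\<close> modulo decomposables, with dual
  coordinates \<open>\<rho>\<close>. Being defined on the whole module and zero on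
  \<open>decomposable_part g\<close>, these stand in for functionals on the quotient.\<close>

lemma ex_complement_of_decomposable_part:
  assumes "fin_dim (restrict_scalars scaleK scaleM) (M g)"
  shows "\<exists>B \<rho>. B \<subseteq> M g \<and> finite B \<and> M g \<subseteq> vs.span (B \<union> decomposable_part g) \<and>
    (\<forall>b\<in>B. Vector_Spaces.linear (restrict_scalars scaleK scaleM) (*) (\<rho> b) \<and>
      (\<forall>x\<in>decomposable_part g. \<rho> b x = 0) \<and>
      (\<forall>c\<in>B. \<rho> b c = (if c = b then 1 else 0)))"
proof -
  \<comment> \<open>\<open>A\<close> is a basis of the decomposable part; it is extended to a basis
    \<open>C\<close> of \<open>M g\<close>, and \<open>C - A\<close> is the complement.\<close>
  obtain A where A: "A \<subseteq> decomposable_part g" "vs.independent A" "decomposable_part g \<subseteq> vs.span A"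
    by (rule vs.maximal_independent_subset_extend[of "{}" "decomposable_part g"]) (auto simp: vs.independent_empty)
  with decomposable_part_subset have "A \<subseteq> M g" by blast
  then obtain C where C: "A \<subseteq> C" "C \<subseteq> M g" "vs.independent C" "M g \<subseteq> vs.span C"
    using A(2) by (rule vs.maximal_independent_subset_extend)
  obtain T where "finite T" "vs.span T = M g"
    using assms by (auto simp: fin_dim_def)
  then have finC: "finite C"
    using vs.independent_span_bound[OF _ C(3)] C(2) by auto
  \<comment> \<open>A basis of the whole space makes the coordinates total linear maps.\<close>
  let ?E = "vs.extend_basis C"
  have E: "C \<subseteq> ?E" "vs.independent ?E" "vs.span ?E = UNIV"
    using C(3) by (simp_all add: vs.extend_basis_superset vs.independent_extend_basis)
  let ?\<rho> = "\<lambda>b x. vs.representation ?E x b"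
  show ?thesis
  proof (intro exI[of _ "C - A"] exI[of _ ?\<rho>] conjI ballI)
    show "C - A \<subseteq> M g" "finite (C - A)"
      using C finC by auto
    have "vs.span C \<subseteq> vs.span (C - A \<union> decomposable_part g)"
      using A by (intro vs.span_mono) auto
    with C(4) show "M g \<subseteq> vs.span (C - A \<union> decomposable_part g)" by blast
    fix b assume b: "b \<in> C - A"
    show "Vector_Spaces.linear (restrict_scalars scaleK scaleM) (*) (?\<rho> b)"
      using E(2,3) by (rule vs.linear_representation)
    show "?\<rho> b x = 0" if "x \<in> decomposable_part g" for x
    proof -
      \<comment> \<open>The coordinates of a decomposable element involve only \<open>A\<close>, and
        \<open>b\<close> is outside \<open>A\<close>.\<close>
      have "vs.representation ?E x = vs.representation A x"
        using that A C E by (intro vs.representation_extend) auto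
      then show ?thesis
        using vs.representation_ne_zero[of A x b] b by auto
    qed
    show "?\<rho> b c = (if c = b then 1 else 0)" if "c \<in> C - A" for c
      using vs.representation_basis[OF E(2), of c] that E(1) by auto
  qed
qed

end

section \<open>Splitting the surjection from a free module\<close>

context module
begin

text \<open>The free module in \<open>projective\<close> is indexed by all elements of the module;
  discarding the coordinates outside \<open>G\<close> leaves the combinations of
  \<open>G\<close>.\<close>

lemma module_hom_combination:
  "module_hom sum_scale scale
     (\<lambda>f. \<Sum>c\<in>Poly_Mapping.keys f \<inter> G. scale (Poly_Mapping.lookup f c) c)"
    (is "module_hom _ _ ?p")
proof -
  \<comment> \<open>Enlarging the index set lets two functions be summed over a common set.\<close>
  have p: "?p f = (\<Sum>c\<in>K. scale (Poly_Mapping.lookup f c) c)"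
    if "finite K" "Poly_Mapping.keys f \<inter> G \<subseteq> K" "K \<subseteq> G" for f K
    using that by (intro sum.mono_neutral_left) (auto simp: in_keys_iff)
  have "?p (f + f') = ?p f + ?p f'" for f f'
  proof -
    let ?K = "(Poly_Mapping.keys f \<union> Poly_Mapping.keys f') \<inter> G"
    have "Poly_Mapping.keys (f + f') \<inter> G \<subseteq> ?K"
      using keys_add[of f f'] by blast
    then have "?p (f + f') = (\<Sum>c\<in>?K. scale (Poly_Mapping.lookup (f + f') c) c)"
      by (intro p) auto
    also have "\<dots> = (\<Sum>c\<in>?K. scale (Poly_Mapping.lookup f c) c) +
        (\<Sum>c\<in>?K. scale (Poly_Mapping.lookup f' c) c)"
      by (simp add: lookup_add scale_left_distrib sum.distrib)
    also have "\<dots> = ?p f + ?p f'"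
      by (intro arg_cong2[of _ _ _ _ "(+)"] p[symmetric]) auto
    finally show ?thesis .
  qed
  moreover have "?p (sum_scale a f) = scale a (?p f)" for a f
  proof -
    have "?p (sum_scale a f) =
        (\<Sum>c\<in>Poly_Mapping.keys f \<inter> G. scale (Poly_Mapping.lookup (sum_scale a f) c) c)"
      by (intro p) (auto simp: in_keys_iff)
    then show ?thesis by (simp add: scale_sum_right)
  qed
  ultimately show ?thesis
    by (simp add: module_hom_iff module_sum_scale module_axioms)
qed

text \<open>One half of the dual basis lemma: the identity is lifted through the surjection, and the
  coordinates of \<open>l\<close> are the dual functionals.\<close>

lemma projective_splitting:
  assumes "projective scale" and "span G = UNIV"
  obtains l where "module_hom scale sum_scale l"
    and "\<And>x. (\<Sum>c\<in>Poly_Mapping.keys (l x) \<inter> G. scale (Poly_Mapping.lookup (l x) c) c) = x"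
proof -
  let ?p = "\<lambda>f. \<Sum>c\<in>Poly_Mapping.keys f \<inter> G. scale (Poly_Mapping.lookup f c) c"
  have "surj ?p"
  proof (rule surjI)
    fix x
    have "\<exists>f. ?p f = x"
    proof -
      obtain t r where t: "finite t" "t \<subseteq> G" "x = (\<Sum>a\<in>t. scale (r a) a)"
        using assms(2) UNIV_I[of x] unfolding span_explicit by blast
      let ?f = "\<lambda>c. if c \<in> t then r c else 0"
      have "finite {c. ?f c \<noteq> 0}"
        by (rule finite_subset[OF _ t(1)]) auto
      then have "Poly_Mapping.lookup (Abs_poly_mapping ?f) = ?f"
        by (rule lookup_Abs_poly_mapping)
      then have "?p (Abs_poly_mapping ?f) = x"
        using t by (auto simp: keys.rep_eq intro!: sum.mono_neutral_cong_left)
      then show ?thesis ..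
    qed
    then show "?p (SOME f. ?p f = x) = x" by (rule someI_ex)
  qed
  then obtain l where "module_hom scale sum_scale l" "?p \<circ> l = (\<lambda>x. x)"
    using assms(1) module_hom_combination[of G] module_hom_ident
    unfolding projective_def projective_wrt_def by blast
  with that show ?thesis by (simp add: fun_eq_iff)
qed

end

section \<open>The order on degrees\<close>

locale bdf_module = graded_module scaleK R scaleM M
  for scaleK :: "'k::field \<Rightarrow> 'r::idom \<Rightarrow> 'r"
    and R :: "'g::ab_group_add \<Rightarrow> 'r set"
    and scaleM :: "'r \<Rightarrow> 'm::ab_group_add \<Rightarrow> 'm"
    and M :: "'g \<Rightarrow> 'm set" +
  assumes PDCF: "PDCF scaleK R" and BDF: "BDF_module scaleK R scaleM M"
begin

lemma Supp_ringI: "x \<in> R g \<Longrightarrow> x \<noteq> 0 \<Longrightarrow> g \<in> Supp R"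
  by (auto simp: Supp_def)

lemma Supp_moduleI: "x \<in> M g \<Longrightarrow> x \<noteq> 0 \<Longrightarrow> g \<in> Supp M"
  by (auto simp: Supp_def)

lemma Supp_ringE:
  assumes "g \<in> Supp R"
  obtains x where "x \<in> R g" "x \<noteq> 0"
  using assms ring.zero_mem by (auto simp: Supp_def)

text \<open>\<open>R\<close> is a domain, so a product of nonzero homogeneous elements is
  nonzero.\<close>

lemma Supp_ring_add: "g \<in> Supp R \<Longrightarrow> h \<in> Supp R \<Longrightarrow> g + h \<in> Supp R"
  by (metis Supp_ringE Supp_ringI mult_closed no_zero_divisors)

lemma one_mem: "1 \<in> R 0"
  using PDCF unfolding PDCF_def by (metis rangeI scale_one)

lemma monoid_le_refl: "monoid_le (Supp R) g g"
  using Supp_ringI[OF one_mem] by (simp add: monoid_le_def)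

lemma monoid_le_trans:
  "monoid_le (Supp R) f g \<Longrightarrow> monoid_le (Supp R) g h \<Longrightarrow> monoid_le (Supp R) f h"
  using Supp_ring_add[of "g - f" "h - g"] by (simp add: monoid_le_def)

lemma monoid_le_antisym:
  assumes "monoid_le (Supp R) g h" "monoid_le (Supp R) h g"
  shows "g = h"
proof -
  have "pointed (Supp R)" using PDCF by (simp add: PDCF_def)
  moreover have "(h - g) + (g - h) = 0" by simp
  ultimately have "h - g = 0"
    using assms unfolding pointed_def monoid_le_def by blast
  then show ?thesis by simp
qed

end

section \<open>Minimal homogeneous generators\<close>

text \<open>The choices from \<open>ex_complement_of_decomposable_part\<close>, fixed in all degrees
  at once.\<close>

locale minimal_generators = bdf_module scaleK R scaleM M
  for scaleK :: "'k::field \<Rightarrow> 'r::idom \<Rightarrow> 'r"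
    and R :: "'g::ab_group_add \<Rightarrow> 'r set"
    and scaleM :: "'r \<Rightarrow> 'm::ab_group_add \<Rightarrow> 'm"
    and M :: "'g \<Rightarrow> 'm set" +
  fixes B :: "'g \<Rightarrow> 'm set" and \<rho> :: "'g \<Rightarrow> 'm \<Rightarrow> 'm \<Rightarrow> 'k"
  assumes B_subset: "B g \<subseteq> M g"
    and finite_B: "finite (B g)"
    and piece_subset_span: "M g \<subseteq> vs.span (B g \<union> decomposable_part g)"
    and linear_\<rho>: "b \<in> B g \<Longrightarrow> Vector_Spaces.linear (restrict_scalars scaleK scaleM) (*) (\<rho> g b)"
    and \<rho>_decomposable: "b \<in> B g \<Longrightarrow> x \<in> decomposable_part g \<Longrightarrow> \<rho> g b x = 0"
    and \<rho>_B: "b \<in> B g \<Longrightarrow> c \<in> B g \<Longrightarrow> \<rho> g b c = (if c = b then 1 else 0)"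
begin

definition gens :: "'m set" where
  "gens = (\<Union>g. B g)"

text \<open>Meaningful for nonzero homogeneous elements, where \<open>homogeneous_unique\<close>
  leaves one choice.\<close>

definition degree :: "'m \<Rightarrow> 'g" where
  "degree x = (SOME g. x \<in> M g)"

text \<open>Otherwise the linear map \<open>\<rho> g 0\<close> would take the value 1 at 0. Hence
  generators have a well-defined degree.\<close>

lemma zero_notin_B: "0 \<notin> B g"
proof
  assume 0: "0 \<in> B g"
  interpret \<rho>: Vector_Spaces.linear "restrict_scalars scaleK scaleM" "(*)" "\<rho> g 0"
    by (rule linear_\<rho>[OF 0])
  show False using \<rho>_B[OF 0 0] \<rho>.zero by simp
qed

lemma degree_B:
  assumes "b \<in> B g"
  shows "degree b = g"
proof -
  have "b \<in> M g" "b \<noteq> 0"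
    using assms B_subset zero_notin_B by blast+
  moreover from this(1) have "b \<in> M (degree b)"
    unfolding degree_def by (rule someI)
  ultimately show ?thesis by (blast intro: vs.homogeneous_unique)
qed

lemma gensE:
  assumes "b \<in> gens"
  obtains "b \<in> B (degree b)" "b \<in> M (degree b)" "b \<noteq> 0"
proof -
  obtain g where "b \<in> B g"
    using assms by (auto simp: gens_def)
  then have "b \<in> B (degree b)"
    by (simp add: degree_B)
  with that B_subset zero_notin_B show ?thesis by blast
qed

text \<open>The degrees lie in \<open>Supp M\<close>, which passes on both bounds, and the
  generators of degree \<open>h\<close> lie in the finite set \<open>B h\<close>.\<close>

lemma BDF_family_degree: "BDF_family (Supp R) gens degree"
proof -
  have sub: "degree ` gens \<subseteq> Supp M"
    by (auto elim!: gensE intro: Supp_moduleI)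
  have "downward_finite (Supp R) (Supp M)" "finitely_bounded_below (Supp R) (Supp M)"
    using BDF by (simp_all add: BDF_module_def)
  then have "finite {u \<in> degree ` gens. monoid_le (Supp R) u g}"
    "finitely_bounded_below (Supp R) (degree ` gens)" for g
    using sub finite_subset[of "{u \<in> degree ` gens. monoid_le (Supp R) u g}"
        "{u \<in> Supp M. monoid_le (Supp R) u g}"]
    unfolding downward_finite_def finitely_bounded_below_def by blast+
  moreover have "{i \<in> gens. degree i = h} \<subseteq> B h" for h
    by (auto elim!: gensE)
  ultimately show ?thesis
    unfolding BDF_family_def downward_finite_def
    using finite_subset[OF _ finite_B] by (intro conjI allI) blast+
qed

text \<open>The graded Nakayama lemma: the well-founded induction is on the number of degrees of
  \<open>M\<close> below \<open>g\<close>.\<close>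

lemma piece_subset_span_gens: "M g \<subseteq> mod.span gens"
proof (induction "card {u \<in> Supp M. monoid_le (Supp R) u g}" arbitrary: g rule: less_induct)
  case less
  show ?case
  proof
    fix x assume x: "x \<in> M g"
    show "x \<in> mod.span gens"
    proof (cases "x = 0")
      case True
      then show ?thesis by (simp add: mod.span_zero)
    next
      case False
      \<comment> \<open>The R-span is also a k-subspace, so it contains a k-span once it contains
        the spanning set.\<close>
      have subspace: "vs.subspace (mod.span gens)"
        by (rule vs.subspaceI)
          (auto simp: restrict_scalars_def intro: mod.span_zero mod.span_add mod.span_scale)
      have "scaleM a y \<in> mod.span gens" if q: "q \<noteq> 0" "a \<in> R q" "y \<in> M (g - q)" for a y q
      proof (cases "a = 0")
        case False
        with q have "q \<in> Supp R" by (auto intro: Supp_ringI)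
        then have le: "monoid_le (Supp R) (g - q) g" by (simp add: monoid_le_def)
        then have "\<not> monoid_le (Supp R) g (g - q)"
          using monoid_le_antisym q(1) by fastforce
        \<comment> \<open>Strict because of \<open>g\<close> itself, which lies in
          \<open>Supp M\<close> as \<open>x\<close> is nonzero.\<close>
        then have "{u \<in> Supp M. monoid_le (Supp R) u (g - q)}
            \<subset> {u \<in> Supp M. monoid_le (Supp R) u g}"
          using le monoid_le_trans monoid_le_refl Supp_moduleI[OF x \<open>x \<noteq> 0\<close>] by blast
        moreover have "finite {u \<in> Supp M. monoid_le (Supp R) u g}"
          using BDF by (simp add: BDF_module_def downward_finite_def)
        ultimately have "M (g - q) \<subseteq> mod.span gens"
          by (intro less psubset_card_mono)
        with q(3) show ?thesis by (auto intro: mod.span_scale)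
      qed (simp add: mod.span_zero)
      then have "decomposable_part g \<subseteq> mod.span gens"
        unfolding decomposable_part_def by (intro vs.span_minimal[OF _ subspace]) auto
      moreover have "B g \<subseteq> mod.span gens"
        by (auto simp: gens_def intro: mod.span_base)
      ultimately have "vs.span (B g \<union> decomposable_part g) \<subseteq> mod.span gens"
        by (intro vs.span_minimal[OF _ subspace]) auto
      with x piece_subset_span show ?thesis by blast
    qed
  qed
qed

lemma span_gens: "mod.span gens = UNIV"
proof -
  have "x \<in> mod.span gens" for x
    by (subst vs.sum_component[of x, symmetric])
      (use piece_subset_span_gens vs.component_mem in \<open>blast intro: mod.span_sum\<close>)
  then show ?thesis by blast
qed

text \<open>Generators are homogeneous, so a relation between them can be cut down to a single
  degree.\<close>

lemma component_combination:
  assumes "K \<subseteq> gens"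
  shows "component M (\<Sum>c\<in>K. scaleM (u c) c) h =
    (\<Sum>c\<in>K. scaleM (component R (u c) (h - degree c)) c)"
  unfolding vs.component_sum using assms
  by (intro sum.cong[OF refl] component_scale) (auto elim!: gensE)

text \<open>Modulo the decomposable elements, only the degree \<open>0\<close> coefficients in the expression of
  a generator survive, and these are scalars because \<open>R\<close> is connected.\<close>

lemma degree_zero_coefficient:
  assumes b: "b \<in> B h" and d: "d \<in> B h"
    and K: "finite K" "K \<subseteq> gens" and eq: "(\<Sum>c\<in>K. scaleM (a c) c) = b"
    and zero: "d \<notin> K \<Longrightarrow> a d = 0"
  shows "component R (a d) 0 = (if b = d then 1 else 0)"
proof -
  interpret \<rho>: Vector_Spaces.linear "restrict_scalars scaleK scaleM" "(*)" "\<rho> h d"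
    by (rule linear_\<rho>[OF d])
  \<comment> \<open>The part of degree \<open>h\<close> of each term; as \<open>b\<close> is
    homogeneous, these still sum to \<open>b\<close>.\<close>
  define t where "t c = scaleM (component R (a c) (h - degree c)) c" for c
  have "component M b h = b"
    using b B_subset vs.component_homogeneous[of b h h] by auto
  then have b_eq: "b = (\<Sum>c\<in>K. t c)"
    unfolding t_def using component_combination[OF K(2), of a h] eq by simp
  have scalar: "\<exists>\<kappa>. component R r 0 = scaleK \<kappa> 1" for r
    using ring.component_mem[of r 0] PDCF by (auto simp: PDCF_def)
  have t_other: "\<rho> h d (t c) = 0" if "c \<in> K" "c \<noteq> d" for c
  proof (cases "degree c = h")
    case True
    with that K have c: "c \<in> B h" by (auto elim!: gensE)
    obtain \<kappa> where "component R (a c) 0 = scaleK \<kappa> 1" using scalar by blast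
    then have "t c = restrict_scalars scaleK scaleM \<kappa> c"
      by (simp add: t_def True restrict_scalars_def)
    then show ?thesis using \<rho>_B[OF d c] that by (simp add: \<rho>.scale)
  next
    case False
    \<comment> \<open>The coefficient left in \<open>t c\<close> has the nonzero degree
      \<open>h - degree c\<close>.\<close>
    have "t c \<in> decomposable_part h"
      unfolding t_def using that K False
      by (intro scale_mem_decomposable_part[OF ring.component_mem, where h = "degree c"])
        (auto elim!: gensE)
    then show ?thesis using \<rho>_decomposable d by blast
  qed
  obtain \<kappa> where \<kappa>: "component R (a d) 0 = scaleK \<kappa> 1" using scalar by blast
  then have "t d = restrict_scalars scaleK scaleM \<kappa> d"
    by (simp add: t_def degree_B[OF d] restrict_scalars_def)
  then have td: "\<rho> h d (t d) = \<kappa>" using \<rho>_B[OF d d] by (simp add: \<rho>.scale)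
  have "(if b = d then 1 else 0) = \<rho> h d b" using \<rho>_B[OF d b] by simp
  also have "\<dots> = (\<Sum>c\<in>K. \<rho> h d (t c))" by (subst b_eq) (rule \<rho>.sum)
  also have "\<dots> = (\<Sum>c\<in>K. if c = d then \<kappa> else 0)"
    using t_other td by (intro sum.cong) auto
  also have "\<dots> = (if d \<in> K then \<kappa> else 0)" using K by simp
  \<comment> \<open>If \<open>d\<close> is outside \<open>K\<close>, the sum is 0 and so is the
    coefficient, by \<open>zero\<close>.\<close>
  finally show ?thesis using \<kappa> zero by (auto split: if_splits)
qed

section \<open>Independence of the generators\<close>

lemma independent_gens:
  assumes "projective scaleM"
  shows "mod.independent gens"
proof
  assume "mod.dependent gens"
  then obtain t u v0 where t: "finite t" "t \<subseteq> gens" "(\<Sum>v\<in>t. scaleM (u v) v) = 0"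
    and v0: "v0 \<in> t" "u v0 \<noteq> 0"
    unfolding mod.dependent_explicit by blast
  obtain l where hom: "module_hom scaleM sum_scale l"
    and l: "\<And>x. (\<Sum>c\<in>Poly_Mapping.keys (l x) \<inter> gens. scaleM (Poly_Mapping.lookup (l x) c) c) = x"
    using mod.projective_splitting[OF assms span_gens] by blast
  interpret l: module_hom scaleM sum_scale l by (rule hom)
  have "\<exists>e. component R (u v0) e \<noteq> 0"
    using ring.sum_component[of "u v0"] v0(2) by (metis (no_types, lifting) sum.neutral)
  then obtain e where e: "component R (u v0) e \<noteq> 0" ..
  \<comment> \<open>With this \<open>h\<close>, the part of degree \<open>h\<close> of the relation
    keeps the nonzero component \<open>e\<close> of \<open>u v0\<close>.\<close>
  define h where "h = e + degree v0"
  define r where "r v = component R (u v) (h - degree v)" for v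
  have r_mem: "r v \<in> R (h - degree v)" for v
    unfolding r_def by (rule ring.component_mem)
  have r_sum: "(\<Sum>v\<in>t. scaleM (r v) v) = 0"
    unfolding r_def component_combination[OF t(2), symmetric] t(3) by simp
  define T where "T = {v \<in> t. r v \<noteq> 0}"
  have "v0 \<in> T" using v0 e by (simp add: T_def r_def h_def)
  \<comment> \<open>Generators of equal degree are incomparable, so a maximal \<open>c\<close> need
    not be unique in its degree; \<open>diag\<close> deals with the others.\<close>
  let ?less = "\<lambda>x y. monoid_le (Supp R) (degree x) (degree y) \<and> degree x \<noteq> degree y"
  have "\<exists>c\<in>T. \<forall>x\<in>T. x \<noteq> c \<longrightarrow> \<not> ?less c x"
  proof (rule Finite_Set.bex_max_element)
    show "finite T" using t by (simp add: T_def)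
    show "asymp_on T ?less" by (auto intro!: asymp_onI dest: monoid_le_antisym)
    show "transp_on T ?less"
      by (rule transp_onI) (metis monoid_le_antisym monoid_le_trans)
    show "T \<noteq> {}" using \<open>v0 \<in> T\<close> by blast
  qed
  then obtain c where c: "c \<in> T" and max: "\<And>x. x \<in> T \<Longrightarrow> x \<noteq> c \<Longrightarrow> \<not> ?less c x" by blast
  \<comment> \<open>The entry of the unitriangular matrix in row \<open>v\<close> and column
    \<open>c\<close>.\<close>
  let ?a = "\<lambda>v. component R (Poly_Mapping.lookup (l v) c) (degree v - degree c)"
  have c_gens: "c \<in> gens" using c t by (auto simp: T_def)
  have diag: "component R (Poly_Mapping.lookup (l v) c) 0 = (if v = c then 1 else 0)"
    if "v \<in> gens" "degree v = degree c" for v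
  proof (rule degree_zero_coefficient[OF _ _ _ _ l])
    show "v \<in> B (degree c)" using that by (metis gensE)
    show "c \<in> B (degree c)" using c_gens by (metis gensE)
  qed (auto simp: in_keys_iff c_gens)
  have "0 = Poly_Mapping.lookup (l (\<Sum>v\<in>t. scaleM (r v) v)) c"
    by (simp add: r_sum l.zero)
  also have "\<dots> = (\<Sum>v\<in>t. r v * Poly_Mapping.lookup (l v) c)"
    by (simp add: l.sum l.scale lookup_sum)
  finally have "(\<Sum>v\<in>t. r v * Poly_Mapping.lookup (l v) c) = 0" ..
  then have "0 = component R (\<Sum>v\<in>t. r v * Poly_Mapping.lookup (l v) c) (h - degree c)"
    by simp
  also have "\<dots> = (\<Sum>v\<in>t. component R (Poly_Mapping.lookup (l v) c * r v) (h - degree c))"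
    by (simp add: ring.component_sum mult.commute)
  \<comment> \<open>As \<open>r v\<close> has degree \<open>h - degree v\<close>, degree
    \<open>h - degree c\<close> of the product selects degree \<open>degree v - degree c\<close> of
    the other factor.\<close>
  also have "\<dots> = (\<Sum>v\<in>t. ?a v * r v)"
    by (simp add: graded_module.component_scale[OF graded_module_self r_mem])
  also have "\<dots> = (\<Sum>v\<in>t. if v = c then r c else 0)"
  proof (rule sum.cong[OF refl])
    fix v assume v: "v \<in> t"
    show "?a v * r v = (if v = c then r c else 0)"
    proof (cases "degree v = degree c")
      case True
      then show ?thesis using diag[of v] v t by auto
    next
      case False
      have "?a v * r v = 0"
      proof (rule ccontr)
        \<comment> \<open>A nonzero product would put \<open>v\<close> in \<open>T\<close> with
          degree strictly above that of \<open>c\<close>, against maximality.\<close>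
        assume nz: "?a v * r v \<noteq> 0"
        then have "degree v - degree c \<in> Supp R"
          by (intro Supp_ringI[OF ring.component_mem]) auto
        with nz v max[of v] False show False
          by (auto simp: T_def monoid_le_def)
      qed
      with False show ?thesis by auto
    qed
  qed
  also have "\<dots> = r c" using c t by (simp add: T_def)
  finally show False using c by (simp add: T_def)
qed

section \<open>Coordinates and the graded isomorphism\<close>

text \<open>The homogeneous parts of the coefficients that contribute to degree \<open>h\<close>
  already represent \<open>x\<close>, so independence forces equality.\<close>

lemma representation_homogeneous:
  assumes ind: "mod.independent gens" and x: "x \<in> M h" and c: "c \<in> gens"
  shows "mod.representation gens x c \<in> R (h - degree c)"
\<comment> \<open>Independence is used on the finite set of nonzero coefficients, which must contain
  \<open>c\<close>.\<close>
proof (cases "mod.representation gens x c = 0")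
  case True
  then show ?thesis using ring.zero_mem by simp
next
  case False
  let ?f = "mod.representation gens x"
  let ?K = "{c. ?f c \<noteq> 0}"
  have K: "finite ?K" "?K \<subseteq> gens"
    using mod.finite_representation mod.representation_ne_zero by auto
  have eq: "(\<Sum>c\<in>?K. scaleM (?f c) c) = x"
    using ind span_gens by (intro mod.sum_nonzero_representation_eq) auto
  have "(\<Sum>c\<in>?K. scaleM (?f c - component R (?f c) (h - degree c)) c) = x - component M x h"
    using component_combination[OF K(2), of ?f h] eq
    by (simp add: mod.scale_left_diff_distrib sum_subtractf)
  also have "\<dots> = 0" using vs.component_homogeneous[OF x] by simp
  finally have "?f c - component R (?f c) (h - degree c) = 0"
    using False by (intro mod.independentD[OF ind K,
          where u = "\<lambda>c. ?f c - component R (?f c) (h - degree c)"]) auto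
  then show ?thesis using ring.component_mem[of "?f c"] by (metis eq_iff_diff_eq_0)
qed

lemma graded_iso_onto_representation:
  assumes ind: "mod.independent gens"
  shows "graded_iso_onto scaleM M sum_scale (sum_carrier gens)
    (sum_grading gens (\<lambda>i. shift R (- degree i)))
    (\<lambda>x. Abs_poly_mapping (mod.representation gens x))" (is "graded_iso_onto _ _ _ _ _ ?\<phi>")
proof -
  \<comment> \<open>Evaluation of coordinates, the inverse of \<open>?\<phi>\<close> on the
    carrier.\<close>
  define \<psi> where "\<psi> f = (\<Sum>c\<in>Poly_Mapping.keys f. scaleM (Poly_Mapping.lookup f c) c)" for f
  have lookup: "Poly_Mapping.lookup (?\<phi> x) = mod.representation gens x" for x
    by (rule lookup_Abs_poly_mapping[OF mod.finite_representation])
  have span [simp]: "x \<in> mod.span gens" for x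
    by (simp add: span_gens)
  have \<psi>_\<phi>: "\<psi> (?\<phi> x) = x" for x
    unfolding \<psi>_def keys.rep_eq lookup using ind by (simp add: mod.sum_nonzero_representation_eq)
  have \<phi>_\<psi>: "?\<phi> (\<psi> f) = f" if "f \<in> sum_carrier gens" for f
  proof -
    have "mod.representation gens (\<psi> f) = Poly_Mapping.lookup f"
      using ind that
      by (intro mod.representation_eqI) (auto simp: \<psi>_def keys.rep_eq sum_carrier_def)
    then show ?thesis by simp
  qed
  have carrier: "?\<phi> x \<in> sum_carrier gens" for x
    using mod.representation_ne_zero
    by (auto simp: sum_carrier_def in_keys_iff lookup simp del: lookup_not_eq_zero_eq_in_keys)
  have "?\<phi> (x + y) = ?\<phi> x + ?\<phi> y" for x y
    by (rule poly_mapping_eqI, unfold lookup lookup_add) (simp add: ind mod.representation_add)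
  moreover have "?\<phi> (scaleM a x) = sum_scale a (?\<phi> x)" for a x
    by (rule poly_mapping_eqI, unfold lookup lookup_sum_scale)
      (simp add: ind mod.representation_scale)
  ultimately have "module_hom scaleM sum_scale ?\<phi>"
    by (simp add: module_hom_iff mod.module_axioms module_sum_scale)
  moreover have "bij_betw ?\<phi> UNIV (sum_carrier gens)"
    by (rule bij_betw_byWitness[where f' = \<psi>]) (auto simp: \<psi>_\<phi> \<phi>_\<psi> carrier)
  \<comment> \<open>The shift by \<open>- degree i\<close> has \<open>R (h - degree i)\<close> in
    degree \<open>h\<close>, matching \<open>representation_homogeneous\<close>.\<close>
  moreover have "?\<phi> ` M h = sum_grading gens (\<lambda>i. shift R (- degree i)) h" for h
  proof (intro equalityI subsetI)
    fix f assume "f \<in> ?\<phi> ` M h"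
    then show "f \<in> sum_grading gens (\<lambda>i. shift R (- degree i)) h"
      using representation_homogeneous[OF ind]
      by (auto simp: sum_grading_def carrier lookup shift_def)
  next
    fix f assume f: "f \<in> sum_grading gens (\<lambda>i. shift R (- degree i)) h"
    then have keys: "Poly_Mapping.keys f \<subseteq> gens"
      by (simp add: sum_grading_def sum_carrier_def)
    have "\<psi> f \<in> M h"
      unfolding \<psi>_def
    proof (rule vs.subspace_sum[OF vs.subspace_piece])
      fix c assume "c \<in> Poly_Mapping.keys f"
      with keys have "c \<in> gens" by blast
      with f have "Poly_Mapping.lookup f c \<in> R (h - degree c)" "c \<in> M (degree c)"
        by (auto simp: sum_grading_def shift_def elim: gensE)
      from scale_closed[OF this] show "scaleM (Poly_Mapping.lookup f c) c \<in> M h" by simp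
    qed
    moreover have "?\<phi> (\<psi> f) = f" using f by (intro \<phi>_\<psi>) (simp add: sum_grading_def)
    ultimately show "f \<in> ?\<phi> ` M h" by (metis imageI)
  qed
  ultimately show ?thesis by (simp add: graded_iso_onto_def)
qed

end

theorem theorem3:
  fixes scaleK :: "'k::field \<Rightarrow> 'r::idom \<Rightarrow> 'r"
    and R :: "'g::ab_group_add \<Rightarrow> 'r set"
    and scaleP :: "'r \<Rightarrow> 'm::ab_group_add \<Rightarrow> 'm"
    and P :: "'g \<Rightarrow> 'm set"
  assumes "PDCF scaleK R"
    and "BDF_module scaleK R scaleP P"
    and "projective scaleP"
  shows "free scaleP \<and>
    (\<exists>(I :: 'm set) (g :: 'm \<Rightarrow> 'g) \<phi>.
       BDF_family (Supp R) I g \<and>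
       graded_iso_onto scaleP P
         sum_scale (sum_carrier I) (sum_grading I (\<lambda>i. shift R (- g i))) \<phi>)"
proof -
  have graded: "graded_module scaleK R scaleP P"
    and fin: "\<And>g. fin_dim (restrict_scalars scaleK scaleP) (P g)"
    using assms(2) by (simp_all add: BDF_module_def)
  interpret bdf_module scaleK R scaleP P
    using graded assms(1,2) by (simp add: bdf_module_def bdf_module_axioms_def)
  \<comment> \<open>The complements exist degree by degree; choice turns them into functions of the
    degree.\<close>
  obtain B \<rho> where "\<And>g. B g \<subseteq> P g \<and> finite (B g) \<and>
      P g \<subseteq> vs.span (B g \<union> decomposable_part g) \<and>
      (\<forall>b\<in>B g. Vector_Spaces.linear (restrict_scalars scaleK scaleP) (*) (\<rho> g b) \<and>
        (\<forall>x\<in>decomposable_part g. \<rho> g b x = 0) \<and>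
        (\<forall>c\<in>B g. \<rho> g b c = (if c = b then 1 else 0)))"
    using ex_complement_of_decomposable_part[OF fin] by metis
  then interpret minimal_generators scaleK R scaleP P B \<rho>
    using bdf_module_axioms
    by (simp add: minimal_generators_def minimal_generators_axioms_def)
  have ind: "mod.independent gens" by (rule independent_gens[OF assms(3)])
  \<comment> \<open>The basis is its own index set: \<open>I\<close> is \<open>gens\<close> and
    \<open>g\<close> is \<open>degree\<close>.\<close>
  then show ?thesis
    unfolding free_def
    using span_gens BDF_family_degree graded_iso_onto_representation by blast
qed

end
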